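(* Let $d=2$ and let $(p_n)_{n\ge 2}$ be a sequence in $[0,1]$ such that, for some $n_0$ and some $\varepsilon>0$, $p_n<n^{-1/2-\varepsilon}$ for all $n\ge n_0$. Let $S$ be the conservative random walk on $\mathbb{Z}^2$ started at the origin corresponding to $(p_n)$. Then $S$ is strongly transient, i.e. $|S_n|\to\infty$ almost surely as $n\to\infty$.
   Context: Conservative random walk on $\mathbb{Z}^d$, $d\ge 2$, corresponding to a sequence $(p_n)_{n\ge 2}$ in $[0,1]$ (with the convention $p_1:=1$): let $e_1,\dots,e_d$ be the standard basis vectors of $\mathbb{R}^d$. Let $Y_1$ be uniform on the $2d$-element set $\{\pm e_1,\dots,\pm e_d\}$, and let $Y_1,Y_2,\dots$ be the (time-inhomogeneous) Markov chain on this set whose transition matrix between times $n$ and $n+1$ is $(1-p_n)I+\frac{p_n}{2d}A$, $n\ge 1$, where $I$ is the $2d\times 2d$ identity matrix and $A$ the $2d\times 2d$ matrix of ones; i.e. with probability $1-p_n$ the next step repeats the previous one, and with probability $p_n$ a fresh direction is chosen uniformly among all $2d$ directions. Set $S_0=\mathbf{0}$, $S_n=Y_1+\dots+Y_n$. $|\cdot|$ is the Euclidean norm. *)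

theory Defs
  imports "HOL-Probability.Probability"
begin

definition directions :: "(real ^ 'd) set" where
  "directions = {axis i s | i s. s = 1 \<or> s = -1}"

text \<open>The sequence is given for indices \<open>n \<ge> 2\<close>; the convention \<open>p\<^sub>1 = 1\<close> is built in here,
  so the values \<open>p 0\<close> and \<open>p 1\<close> are never used.\<close>

definition refresh_prob :: "(nat \<Rightarrow> real) \<Rightarrow> nat \<Rightarrow> real" where
  "refresh_prob p n = (if n = 1 then 1 else p n)"

text \<open>Entry \<open>(x, y)\<close> of the matrix \<open>(1 - p\<^sub>n) I + (p\<^sub>n / (2 d)) A\<close>, where \<open>A\<close> is the all-ones
  matrix; rows and columns are indexed by the directions.\<close>

definition step_matrix :: "(nat \<Rightarrow> real) \<Rightarrow> nat \<Rightarrow> real ^ 'd \<Rightarrow> real ^ 'd \<Rightarrow> real" where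
  "step_matrix p n x y =
     (1 - refresh_prob p n) * of_bool (x = y) + refresh_prob p n / (2 * real CARD('d))"

text \<open>\<open>Y n\<close> is the \<open>n\<close>-th step, \<open>n \<ge> 1\<close>; the value \<open>Y 0\<close> is unconstrained and never used.
  The last assumption is the Markov property together with the transition probabilities: given
  any history \<open>Y 1 = y 1, \<dots>, Y n = y n\<close> of positive probability, the next step has the law given
  by row \<open>y n\<close> of the \<open>n\<close>-th matrix.\<close>

locale conservative_steps = prob_space M
  for M :: "'w measure" +
  fixes p :: "nat \<Rightarrow> real"
    and Y :: "nat \<Rightarrow> 'w \<Rightarrow> real ^ 'd"
  assumes step_measurable: "\<And>n. n \<ge> 1 \<Longrightarrow> Y n \<in> measurable M (count_space directions)"
    and first_step: "\<And>e. e \<in> directions \<Longrightarrow> \<P>(\<omega> in M. Y 1 \<omega> = e) = 1 / (2 * real CARD('d))"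
    and markov_step: "\<And>n y e. n \<ge> 1 \<Longrightarrow> e \<in> directions \<Longrightarrow>
      \<P>(\<omega> in M. \<forall>k\<in>{1..n}. Y k \<omega> = y k) > 0 \<Longrightarrow>
      \<P>(\<omega> in M. Y (n + 1) \<omega> = e \<bar> \<forall>k\<in>{1..n}. Y k \<omega> = y k) = step_matrix p n (y n) e"

definition walk :: "(nat \<Rightarrow> 'w \<Rightarrow> real ^ 'd) \<Rightarrow> nat \<Rightarrow> 'w \<Rightarrow> real ^ 'd" where
  "walk Y n \<omega> = (\<Sum>k = 1..n. Y k \<omega>)"

definition strongly_transient :: "'w measure \<Rightarrow> (nat \<Rightarrow> 'w \<Rightarrow> real ^ 'd) \<Rightarrow> bool" where
  "strongly_transient M S \<longleftrightarrow> (AE \<omega> in M. filterlim (\<lambda>n. norm (S n \<omega>)) at_top sequentially)"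

end

theory Submission
  imports Defs
begin

text \<open>Call \<open>s\<close> a turn if \<open>Y (s + 1) \<noteq> Y s\<close>; the path then runs straight until the next turn \<open>t\<close>.
  Once the path up to time \<open>s + 1\<close> is known, the coordinate along the run is a strictly monotone
  function of \<open>t\<close>, so it lies in \<open>[-R, R]\<close> for at most \<open>2 * R + 1\<close> values of \<open>t\<close>. Each of these has
  conditional probability at most \<open>s powr (-1/2 - \<epsilon>)\<close>, and \<open>s\<close> is a turn with probability at most
  \<open>s powr (-1/2 - \<epsilon>)\<close>. As \<open>s powr (-1 - 2 * \<epsilon>)\<close> is summable, almost surely all but finitely many runs
  end with their coordinate outside \<open>[-R, R]\<close>. If \<open>p\<close> is not summable, there are infinitely many
  turns between the two axes; the coordinate orthogonal to the current direction is frozen at its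
  value at the end of an earlier run, hence eventually exceeds \<open>R\<close> in absolute value. If \<open>p\<close> is
  summable, there are only finitely many turns and the path is eventually a straight line.\<close>

section \<open>Directions of the plane and row sums of the transition matrix\<close>

lemma directions_2: "(directions :: (real ^ 2) set) = {axis 1 1, axis 1 (-1), axis 2 1, axis 2 (-1)}"
proof (intro equalityI subsetI)
  fix e :: "real ^ 2" assume "e \<in> directions"
  then obtain i s where "e = axis i s" "s = 1 \<or> s = -1" by (auto simp: directions_def)
  then show "e \<in> {axis 1 1, axis 1 (-1), axis 2 1, axis 2 (-1)}" using exhaust_2[of i] by auto
qed (auto simp: directions_def)

lemma finite_directions: "finite (directions :: (real ^ 'd) set)"
proof -
  have "(directions :: (real ^ 'd) set) = (\<lambda>(i, s). axis i s) ` (UNIV \<times> {1, -1})"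
    by (auto simp: directions_def)
  also have "finite \<dots>" by (intro finite_imageI finite_cartesian_product) auto
  finally show ?thesis .
qed

lemma norm_direction: "e \<in> directions \<Longrightarrow> norm e = 1"
  by (auto simp: directions_def norm_eq_1 inner_axis_axis)

lemma inner_direction_self: "e \<in> directions \<Longrightarrow> e \<bullet> e = 1"
  by (simp add: norm_direction dot_square_norm)

text \<open>Orthogonal directions of the plane lie on different axes, and \<open>g\<close> lies on
  exactly one of the two.\<close>

lemma orthogonal_2:
  fixes e f g :: "real ^ 2"
  assumes "e \<in> directions" "f \<in> directions" "g \<in> directions" "e \<bullet> f = 0"
  shows "g \<bullet> e = 0 \<longleftrightarrow> g \<bullet> f \<noteq> 0"
  using assms by (auto simp: directions_2 inner_axis_axis)

text \<open>Three of the four entries of the row lie off the diagonal, each equal to a quarter of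
  \<open>refresh_prob p n\<close>. The sum is the same for every \<open>f\<close>, as
  \<open>prob_path_event_step\<close> requires.\<close>

lemma sum_turn:
  fixes f :: "real ^ 2"
  assumes "f \<in> directions"
  shows "(\<Sum>e | e \<in> directions \<and> e \<noteq> f. step_matrix p n f e) = 3 / 4 * refresh_prob p n"
proof -
  have "(\<Sum>e | e \<in> directions \<and> e \<noteq> f. step_matrix p n f e)
      = (\<Sum>e \<in> directions. if e \<noteq> f then step_matrix p n f e else 0)"
    by (rule sum.mono_neutral_cong_left) (auto simp: finite_directions)
  also have "\<dots> = 3 / 4 * refresh_prob p n"
    using assms by (auto simp: directions_2 step_matrix_def axis_eq_axis)
  finally show ?thesis .
qed

text \<open>The row sums to 1, and the two directions orthogonal to \<open>f\<close> carry a quarter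
  of \<open>refresh_prob p n\<close> each.\<close>

lemma sum_not_orthogonal:
  fixes f :: "real ^ 2"
  assumes "f \<in> directions"
  shows "(\<Sum>e | e \<in> directions \<and> f \<bullet> e \<noteq> 0. step_matrix p n f e) = 1 - refresh_prob p n / 2"
proof -
  have "(\<Sum>e | e \<in> directions \<and> f \<bullet> e \<noteq> 0. step_matrix p n f e)
      = (\<Sum>e \<in> directions. if f \<bullet> e \<noteq> 0 then step_matrix p n f e else 0)"
    by (rule sum.mono_neutral_cong_left) (auto simp: finite_directions)
  also have "\<dots> = 1 - refresh_prob p n / 2"
    using assms by (auto simp: directions_2 step_matrix_def axis_eq_axis inner_axis_axis)
  finally show ?thesis .
qed

section \<open>Deterministic paths and their straight runs\<close>

text \<open>Stated for a fixed path, so that geometry and probability stay separate. The time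
  \<open>t\<close> is the first turn after \<open>s\<close>, and the inner product is, up to sign,
  the coordinate along the run at its end.\<close>

definition run_ends_near :: "(nat \<Rightarrow> real ^ 'd) \<Rightarrow> nat \<Rightarrow> nat \<Rightarrow> bool" where
  "run_ends_near y R s \<longleftrightarrow> y (s + 1) \<noteq> y s \<and>
     (\<exists>t>s. (\<forall>u\<in>{s+1..t}. y u = y (s + 1)) \<and> y (t + 1) \<noteq> y t \<and> \<bar>(\<Sum>k=1..t. y k) \<bullet> y t\<bar> \<le> R)"

text \<open>The run adds \<open>t - s\<close> copies of one unit vector to the position at time
  \<open>s\<close>. This is the strict monotonicity in \<open>t\<close> on which the counting
  rests.\<close>

lemma inner_end_of_run:
  fixes y :: "nat \<Rightarrow> real ^ 'd"
  assumes "s < t" "\<forall>u\<in>{s+1..t}. y u = y (s + 1)" "y (s + 1) \<in> directions"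
  shows "(\<Sum>k=1..t. y k) \<bullet> y t = (\<Sum>k=1..s. y k) \<bullet> y (s + 1) + real (t - s)"
proof -
  have "(\<Sum>k=1..t. y k) = (\<Sum>k=1..s. y k) + (\<Sum>k=s+1..t. y k)"
    using sum.ub_add_nat[of 1 s y "t - s"] \<open>s < t\<close> by simp
  also have "(\<Sum>k=s+1..t. y k) = (\<Sum>k=s+1..t. y (s + 1))"
    by (rule sum.cong[OF refl]) (rule bspec[OF assms(2)])
  also have "\<dots> = real (t - s) *\<^sub>R y (s + 1)" by (simp add: sum_constant_scaleR del: sum_constant)
  finally have "(\<Sum>k=1..t. y k) = (\<Sum>k=1..s. y k) + real (t - s) *\<^sub>R y (s + 1)" .
  moreover have "y t = y (s + 1)" using assms(1) by (intro bspec[OF assms(2)]) simp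
  ultimately show ?thesis
    using inner_direction_self[OF assms(3)] by (simp only: inner_add_left inner_scaleR_left mult_1_right)
qed

text \<open>At time \<open>s\<close> every coordinate is at most \<open>s\<close> in absolute value,
  so a run ending within \<open>R\<close> has length at most \<open>s + R\<close>; this makes the
  range of \<open>t\<close> finite. The conjuncts are grouped by the time at which they are decided:
  first \<open>s + 1\<close>, then \<open>t\<close>, and finally the turn at
  \<open>t\<close>.\<close>

lemma run_ends_near_iff:
  fixes y :: "nat \<Rightarrow> real ^ 'd"
  assumes dir: "\<And>k. k \<ge> 1 \<Longrightarrow> y k \<in> directions"
  shows "run_ends_near y R s \<longleftrightarrow> (\<exists>t\<in>{s+1..2 * s + R}.
     ((y (s + 1) \<noteq> y s \<and> \<bar>(\<Sum>k=1..s. y k) \<bullet> y (s + 1) + real (t - s)\<bar> \<le> R) \<and>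
       (\<forall>u\<in>{s+1..t}. y u = y (s + 1))) \<and> y (t + 1) \<noteq> y t)" (is "_ \<longleftrightarrow> ?R")
proof -
  have dir': "y (s + 1) \<in> directions" by (rule dir) simp
  show ?thesis
  proof
    assume "run_ends_near y R s"
    then obtain t where t: "s < t" "\<forall>u\<in>{s+1..t}. y u = y (s + 1)" "y (s + 1) \<noteq> y s"
        "y (t + 1) \<noteq> y t" "\<bar>(\<Sum>k=1..t. y k) \<bullet> y t\<bar> \<le> R"
      unfolding run_ends_near_def by blast
    note eq = inner_end_of_run[OF t(1,2) dir']
    have "\<bar>(\<Sum>k=1..s. y k) \<bullet> y (s + 1)\<bar> \<le> norm (\<Sum>k=1..s. y k) * norm (y (s + 1))"
      by (rule Cauchy_Schwarz_ineq2)
    also have "\<dots> = norm (\<Sum>k=1..s. y k)" using norm_direction[OF dir'] by simp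
    also have "\<dots> \<le> (\<Sum>k=1..s. 1)"
    proof (rule sum_norm_le)
      fix k assume "k \<in> {1..s}"
      then show "norm (y k) \<le> 1" using norm_direction[OF dir[of k]] by simp
    qed
    finally have "\<bar>(\<Sum>k=1..s. y k) \<bullet> y (s + 1)\<bar> \<le> real s" by simp
    then have "real (t - s) \<le> real R + real s" using t(5) unfolding eq by linarith
    then have "t \<in> {s+1..2 * s + R}" using t(1) by auto
    with t(2-4) t(5)[unfolded eq] show ?R by blast
  next
    assume ?R
    then obtain t where t: "t \<in> {s+1..2 * s + R}" "y (s + 1) \<noteq> y s"
      "\<bar>(\<Sum>k=1..s. y k) \<bullet> y (s + 1) + real (t - s)\<bar> \<le> R"
      "\<forall>u\<in>{s+1..t}. y u = y (s + 1)" "y (t + 1) \<noteq> y t" by blast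
    from t(1) have "s < t" by simp
    from t(3) have "\<bar>(\<Sum>k=1..t. y k) \<bullet> y t\<bar> \<le> R"
      unfolding inner_end_of_run[OF \<open>s < t\<close> t(4) dir'] .
    with t(2,4,5) \<open>s < t\<close> show "run_ends_near y R s"
      unfolding run_ends_near_def by blast
  qed
qed

lemma constant_between:
  fixes y :: "nat \<Rightarrow> 'a"
  assumes "\<And>u. \<lbrakk>m < u; u < n\<rbrakk> \<Longrightarrow> y (u + 1) = y u" "m < u" "u \<le> n"
  shows "y u = y (m + 1)"
proof -
  have "m + 1 \<le> u" using assms by simp
  then show ?thesis
    using assms(3)
  proof (induction u rule: dec_induct)
    case (step u)
    then show ?case using assms(1)[of u] by simp
  qed simp
qed

text \<open>After the last turn the position is affine in \<open>n\<close> with unit velocity, so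
  the triangle inequality bounds its norm below by \<open>n\<close> minus a constant.\<close>

lemma straight_path_unbounded:
  fixes y :: "nat \<Rightarrow> real ^ 'd"
  assumes dir: "\<And>k. k \<ge> 1 \<Longrightarrow> y k \<in> directions"
    and straight: "\<forall>\<^sub>F n in sequentially. y (n + 1) = y n"
  shows "filterlim (\<lambda>n. norm (\<Sum>k=1..n. y k)) at_top sequentially"
proof -
  obtain N0 where N0: "\<And>n. n \<ge> N0 \<Longrightarrow> y (n + 1) = y n"
    using straight by (auto simp: eventually_sequentially)
  \<comment> \<open>The shift makes \<open>N\<close> positive, so that \<open>dir\<close> applies to
    \<open>y N\<close>.\<close>
  define N where "N = Suc N0"
  have const: "y n = y N" if "n \<ge> N" for n
    using constant_between[of N0 n y n] constant_between[of N0 n y N] N0 that by (auto simp: N_def)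
  have e: "norm (y N) = 1" using dir[of N] norm_direction by (auto simp: N_def)
  have sum_eq: "(\<Sum>k=1..n. y k) = (\<Sum>k=1..N. y k) + real (n - N) *\<^sub>R y N" if "n \<ge> N" for n
    using that
  proof (induction n rule: dec_induct)
    case (step n)
    have "y (Suc n) = y N" by (rule const) (use step in simp)
    with step show ?case by (simp add: Suc_diff_le algebra_simps)
  qed simp
  have "real n - (real N + norm (\<Sum>k=1..N. y k)) \<le> norm (\<Sum>k=1..n. y k)" if "n \<ge> N" for n
  proof -
    have "real (n - N) = norm (real (n - N) *\<^sub>R y N)" using e by simp
    also have "real (n - N) *\<^sub>R y N = (\<Sum>k=1..n. y k) - (\<Sum>k=1..N. y k)"
      using sum_eq[OF that] by simp
    also have "norm \<dots> \<le> norm (\<Sum>k=1..n. y k) + norm (\<Sum>k=1..N. y k)"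
      by (rule norm_triangle_ineq4)
    finally show ?thesis using that by simp
  qed
  then have "\<forall>\<^sub>F n in sequentially. real n - (real N + norm (\<Sum>k=1..N. y k)) \<le> norm (\<Sum>k=1..n. y k)"
    by (auto simp: eventually_sequentially)
  moreover have "filterlim (\<lambda>n. real n - (real N + norm (\<Sum>k=1..N. y k))) at_top sequentially"
    using filterlim_tendsto_add_at_top[OF tendsto_const filterlim_real_sequentially,
      of "- (real N + norm (\<Sum>k=1..N. y k))"] by (simp add: algebra_simps)
  ultimately show ?thesis by (rule filterlim_at_top_mono[rotated])
qed

text \<open>For large \<open>n\<close> take the last time \<open>t\<close> up to \<open>n\<close>
  whose step is orthogonal to \<open>y n\<close>. All later steps up to \<open>n\<close> are
  orthogonal to \<open>y t\<close>, so the coordinate along \<open>y t\<close> is frozen from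
  \<open>t\<close> to \<open>n\<close>. Its value was reached at the end of a run that began late,
  hence exceeds \<open>R\<close> in absolute value.\<close>

lemma turning_path_unbounded:
  fixes y :: "nat \<Rightarrow> real ^ 2"
  assumes dir: "\<And>k. k \<ge> 1 \<Longrightarrow> y k \<in> directions"
    and runs: "\<And>R. \<forall>\<^sub>F s in sequentially. \<not> run_ends_near y R s"
    and turns: "\<And>N. \<exists>n\<ge>N. y n \<bullet> y (n + 1) = 0"
  shows "filterlim (\<lambda>n. norm (\<Sum>k=1..n. y k)) at_top sequentially"
proof -
  have "\<forall>\<^sub>F n in sequentially. real R \<le> norm (\<Sum>k=1..n. y k)" for R
  proof -
    obtain N where N: "\<And>s. s \<ge> N \<Longrightarrow> \<not> run_ends_near y R s"
      using runs[of R] by (auto simp: eventually_sequentially)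
    \<comment> \<open>Two orthogonal turns are needed: \<open>m1\<close> guarantees that
      \<open>t\<close> exists and is at least \<open>m1\<close>, while \<open>m0\<close> guarantees
      a turn before \<open>t\<close> and after \<open>N\<close>, so that the run ending at
      \<open>t\<close> starts late enough for \<open>N\<close> to apply.\<close>
    obtain m0 where m0: "m0 \<ge> Suc N" "y m0 \<bullet> y (m0 + 1) = 0" using turns by blast
    obtain m1 where m1: "m1 \<ge> Suc m0" "y m1 \<bullet> y (m1 + 1) = 0" using turns by blast
    have self: "y k \<bullet> y k = 1" if "k \<ge> 1" for k
      using dir[OF that] by (rule inner_direction_self)
    have "real R \<le> norm (\<Sum>k=1..n. y k)" if n: "n \<ge> m1 + 1" for n
    proof -
      define P where "P t \<longleftrightarrow> m1 \<le> t \<and> t \<le> n \<and> y t \<bullet> y n = 0" for t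
      \<comment> \<open>The steps at \<open>m1\<close> and \<open>m1 + 1\<close> lie on different
        axes, so one of them is orthogonal to \<open>y n\<close>.\<close>
      have "P m1 \<or> P (m1 + 1)"
        using orthogonal_2[of "y m1" "y (m1+1)" "y n"] dir m1 m0 n
        by (auto simp: P_def inner_commute)
      then have ex: "\<exists>t. P t" by blast
      define t where "t = (GREATEST t. P t)"
      have bound: "\<And>t. P t \<Longrightarrow> t \<le> n" by (simp add: P_def)
      have "P t" unfolding t_def using ex bound by (metis GreatestI_nat)
      then have t: "m1 \<le> t" "t \<le> n" "y t \<bullet> y n = 0" by (auto simp: P_def)
      have after: "y u \<bullet> y t = 0" if "u \<in> {t+1..n}" for u
      proof -
        have "\<not> P u"
          using that Greatest_le_nat[of P u n] bound unfolding t_def[symmetric] by fastforce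
        then show ?thesis
          using orthogonal_2[of "y t" "y n" "y u"] that t dir m0 m1 by (auto simp: P_def)
      qed
      have "t < n" using t self[of n] m0 m1 by (cases "t = n") auto
      have "(\<Sum>k=1..n. y k) = (\<Sum>k=1..t. y k) + (\<Sum>k=t+1..n. y k)"
        using sum.ub_add_nat[of 1 t y "n - t"] t by simp
      then have inner: "(\<Sum>k=1..n. y k) \<bullet> y t = (\<Sum>k=1..t. y k) \<bullet> y t"
        using after by (simp add: inner_add_left inner_sum_left)
      have turn_t: "y (t + 1) \<noteq> y t"
        using after[of "t+1"] self[of t] \<open>t < n\<close> t m0 m1 by auto
      \<comment> \<open>The greatest such \<open>s\<close> is the turn that opens the run ending at
        \<open>t\<close>.\<close>
      define Q where "Q s \<longleftrightarrow> s < t \<and> y (s + 1) \<noteq> y s" for s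
      have "Q m0" using m0 m1 t self[of m0] by (auto simp: Q_def)
      define s where "s = (GREATEST s. Q s)"
      have boundQ: "\<And>s. Q s \<Longrightarrow> s \<le> t" by (simp add: Q_def)
      have "Q s" unfolding s_def using \<open>Q m0\<close> boundQ by (metis GreatestI_nat)
      have "m0 \<le> s" unfolding s_def using \<open>Q m0\<close> boundQ by (metis Greatest_le_nat)
      have const: "y u = y (s + 1)" if "u \<in> {s+1..t}" for u
      proof (rule constant_between[of s t])
        fix u assume "s < u" "u < t"
        then have "\<not> Q u" using Greatest_le_nat[of Q u t] boundQ unfolding s_def[symmetric] by fastforce
        with \<open>u < t\<close> show "y (u + 1) = y u" by (simp add: Q_def)
      qed (use that in auto)
      have "\<not> run_ends_near y R s" using N \<open>m0 \<le> s\<close> m0 by simp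
      moreover have "s < t" "y (s + 1) \<noteq> y s" using \<open>Q s\<close> by (auto simp: Q_def)
      ultimately have "real R < \<bar>(\<Sum>k=1..t. y k) \<bullet> y t\<bar>"
        using turn_t const unfolding run_ends_near_def by (meson not_le)
      also have "\<dots> \<le> norm (\<Sum>k=1..n. y k) * norm (y t)"
        unfolding inner[symmetric] by (rule Cauchy_Schwarz_ineq2)
      also have "norm (y t) = 1" using dir[of t] t m0 m1 norm_direction by auto
      finally show ?thesis by simp
    qed
    then show ?thesis by (auto simp: eventually_sequentially)
  qed
  then show ?thesis
    unfolding filterlim_at_top
    by (metis (mono_tags, lifting) eventually_mono order_trans real_arch_simple)
qed

section \<open>Events decided by finitely many steps and the Markov property\<close>

text \<open>Combinatorial counterpart of measurability with respect to the first \<open>n\<close>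
  steps. Index 0 is left out because \<open>Y 0\<close> is unconstrained.\<close>

definition depends_upto :: "nat \<Rightarrow> ((nat \<Rightarrow> 'a) \<Rightarrow> bool) \<Rightarrow> bool" where
  "depends_upto n Q \<longleftrightarrow> (\<forall>y z. (\<forall>k\<in>{1..n}. y k = z k) \<longrightarrow> Q y = Q z)"

lemma depends_uptoI:
  assumes "\<And>y z. (\<And>k. \<lbrakk>1 \<le> k; k \<le> n\<rbrakk> \<Longrightarrow> y k = z k) \<Longrightarrow> Q y = Q z"
  shows "depends_upto n Q"
  unfolding depends_upto_def
proof (intro allI impI)
  fix y z :: "nat \<Rightarrow> 'a"
  assume eq: "\<forall>k\<in>{1..n}. y k = z k"
  show "Q y = Q z"
    by (rule assms[of y z]) (use eq in simp)
qed

lemma depends_uptoD: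
  assumes "depends_upto n Q" and "\<And>k. \<lbrakk>1 \<le> k; k \<le> n\<rbrakk> \<Longrightarrow> y k = z k"
  shows "Q y = Q z"
proof -
  have "(\<forall>k\<in>{1..n}. y k = z k) \<longrightarrow> Q y = Q z"
    using spec[OF spec[OF assms(1)[unfolded depends_upto_def], of y], of z] .
  then show ?thesis using assms(2) by simp
qed

context conservative_steps
begin

definition path_event :: "((nat \<Rightarrow> real ^ 'd) \<Rightarrow> bool) \<Rightarrow> 'w set" where
  "path_event Q = {\<omega> \<in> space M. Q (\<lambda>k. Y k \<omega>)}"

lemma step_in_directions: "\<lbrakk>n \<ge> 1; \<omega> \<in> space M\<rbrakk> \<Longrightarrow> Y n \<omega> \<in> directions"
  using measurable_space[OF step_measurable] by auto

lemma step_event: "n \<ge> 1 \<Longrightarrow> {\<omega> \<in> space M. Y n \<omega> = e} \<in> events"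
proof -
  assume n: "n \<ge> 1"
  have "{\<omega> \<in> space M. Y n \<omega> = e} = Y n -` ({e} \<inter> directions) \<inter> space M"
    using step_in_directions[OF n] by auto
  also have "\<dots> \<in> events" by (rule measurable_sets[OF step_measurable[OF n]]) auto
  finally show ?thesis .
qed

text \<open>This is the conditioning event of \<open>markov_step\<close>.\<close>

definition cylinder :: "nat \<Rightarrow> (nat \<Rightarrow> real ^ 'd) \<Rightarrow> 'w set" where
  "cylinder n y = {\<omega> \<in> space M. \<forall>k\<in>{1..n}. Y k \<omega> = y k}"

lemma cylinder_event: "cylinder n y \<in> events"
  unfolding cylinder_def by (rule sets.sets_Collect_finite_All) (auto intro: step_event)

lemma cylinder_disjoint:
  assumes "y \<in> {1..n} \<rightarrow>\<^sub>E A" "z \<in> {1..n} \<rightarrow>\<^sub>E A" "y \<noteq> z"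
  shows "cylinder n y \<inter> cylinder n z = {}"
proof (rule equals0I)
  fix \<omega> assume "\<omega> \<in> cylinder n y \<inter> cylinder n z"
  then have "y k = z k" if "k \<in> {1..n}" for k
    using that by (metis (mono_tags, lifting) IntD1 IntD2 cylinder_def mem_Collect_eq)
  with assms show False by (metis PiE_ext)
qed

text \<open>Extensional functions give one representative per history. As there are finitely many,
  measurability and probabilities reduce to finite disjoint unions of cylinders.\<close>

lemma path_event_cylinders:
  assumes "depends_upto n Q"
  shows "path_event Q = (\<Union>y\<in>{y \<in> {1..n} \<rightarrow>\<^sub>E directions. Q y}. cylinder n y)" (is "_ = ?R")
proof
  show "path_event Q \<subseteq> ?R"
  proof
    fix \<omega> assume w: "\<omega> \<in> path_event Q"
    let ?y = "restrict (\<lambda>k. Y k \<omega>) {1..n}"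
    have "Q ?y = Q (\<lambda>k. Y k \<omega>)"
      by (rule depends_uptoD[OF assms]) auto
    moreover have "?y \<in> {1..n} \<rightarrow>\<^sub>E directions"
      using w step_in_directions by (auto simp: path_event_def)
    moreover have "\<omega> \<in> cylinder n ?y" "Q (\<lambda>k. Y k \<omega>)"
      using w by (auto simp: path_event_def cylinder_def)
    ultimately show "\<omega> \<in> ?R" by blast
  qed
  show "?R \<subseteq> path_event Q"
  proof
    fix \<omega> assume "\<omega> \<in> ?R"
    then obtain y where y: "Q y" "\<omega> \<in> cylinder n y" by blast
    have "Q (\<lambda>k. Y k \<omega>) = Q y"
      by (rule depends_uptoD[OF assms]) (use y in \<open>simp add: cylinder_def\<close>)
    with y show "\<omega> \<in> path_event Q" by (simp add: path_event_def cylinder_def)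
  qed
qed

lemma finite_histories: "finite ({1..n::nat} \<rightarrow>\<^sub>E (directions :: (real ^ 'd) set))"
  by (intro finite_PiE) (auto simp: finite_directions)

lemma path_event_sets:
  assumes "depends_upto n Q"
  shows "path_event Q \<in> events"
  unfolding path_event_cylinders[OF assms]
  using finite_histories by (intro sets.finite_UN) (auto intro: cylinder_event)

lemma prob_path_event:
  assumes "depends_upto n Q"
  shows "prob (path_event Q) = (\<Sum>y | y \<in> {1..n} \<rightarrow>\<^sub>E directions \<and> Q y. prob (cylinder n y))"
  unfolding path_event_cylinders[OF assms]
proof (rule finite_measure_finite_Union)
  show "finite {y \<in> {1..n} \<rightarrow>\<^sub>E directions. Q (y :: nat \<Rightarrow> real ^ 'd)}" using finite_histories by auto
  show "disjoint_family_on (cylinder n) {y \<in> {1..n} \<rightarrow>\<^sub>E directions. Q y}"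
    unfolding disjoint_family_on_def using cylinder_disjoint by blast
qed (auto intro: cylinder_event)

text \<open>Product form of the Markov property. It also covers histories of probability zero, where
  \<open>markov_step\<close> says nothing and both sides vanish.\<close>

lemma prob_next_step:
  assumes n: "n \<ge> 1" and e: "e \<in> directions"
  shows "prob {\<omega> \<in> cylinder n y. Y (n + 1) \<omega> = e} = step_matrix p n (y n) e * prob (cylinder n y)"
proof (cases "prob (cylinder n y) = 0")
  case True
  have "{\<omega> \<in> cylinder n y. Y (n + 1) \<omega> = e} \<subseteq> cylinder n y" by auto
  then have "prob {\<omega> \<in> cylinder n y. Y (n + 1) \<omega> = e} \<le> prob (cylinder n y)"
    by (rule finite_measure_mono) (rule cylinder_event)
  with True show ?thesis by (simp add: measure_le_0_iff)
next
  case False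
  then have "\<P>(\<omega> in M. \<forall>k\<in>{1..n}. Y k \<omega> = y k) > 0"
    by (simp add: zero_less_measure_iff cylinder_def)
  from markov_step[OF n e this] False show ?thesis
    by (simp add: cond_prob_def field_simps conj_ac cylinder_def)
qed

lemma prob_path_event_step:
  assumes n: "n \<ge> 1" and dep: "depends_upto n Q"
    and q: "\<And>f. f \<in> directions \<Longrightarrow> (\<Sum>e | e \<in> directions \<and> G f e. step_matrix p n f e) = q"
  shows "prob (path_event (\<lambda>y. Q y \<and> G (y n) (y (n + 1)))) = q * prob (path_event Q)"
proof -
  let ?H = "{y. y \<in> {1..n} \<rightarrow>\<^sub>E directions \<and> Q y}"
  let ?E = "\<lambda>y. {e. e \<in> directions \<and> G (y n) e}"
  define C where "C x = {\<omega> \<in> cylinder n (fst x). Y (n + 1) \<omega> = snd x}" for x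
  have fin: "finite (Sigma ?H ?E)"
    using finite_histories finite_directions by (intro finite_SigmaI) auto
  have "path_event (\<lambda>y. Q y \<and> G (y n) (y (n + 1)))
      = path_event Q \<inter> {\<omega> \<in> space M. G (Y n \<omega>) (Y (n + 1) \<omega>)}"
    by (auto simp: path_event_def)
  also have "\<dots> = (\<Union>x\<in>Sigma ?H ?E. C x)"
    (is "?L = _")
  proof
    show "?L \<subseteq> (\<Union>x\<in>Sigma ?H ?E. C x)"
    proof
      fix \<omega> assume w: "\<omega> \<in> ?L"
      then obtain y where y: "y \<in> ?H" "\<omega> \<in> cylinder n y"
        unfolding path_event_cylinders[OF dep] by blast
      then have "Y n \<omega> = y n" using n by (simp add: cylinder_def)
      with w y have "(y, Y (n + 1) \<omega>) \<in> Sigma ?H ?E" "\<omega> \<in> C (y, Y (n + 1) \<omega>)"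
        using step_in_directions[of "n + 1" \<omega>] by (auto simp: C_def)
      then show "\<omega> \<in> (\<Union>x\<in>Sigma ?H ?E. C x)" by blast
    qed
    show "(\<Union>x\<in>Sigma ?H ?E. C x) \<subseteq> ?L"
    proof
      fix \<omega> assume "\<omega> \<in> (\<Union>x\<in>Sigma ?H ?E. C x)"
      then obtain y where y: "y \<in> ?H" "\<omega> \<in> cylinder n y" "G (y n) (Y (n + 1) \<omega>)"
        by (auto simp: C_def)
      then have "Y n \<omega> = y n" "\<omega> \<in> space M" using n by (simp_all add: cylinder_def)
      with y show "\<omega> \<in> ?L" unfolding path_event_cylinders[OF dep] by auto
    qed
  qed
  also have "prob \<dots> = (\<Sum>x\<in>Sigma ?H ?E. prob (C x))"
  proof (rule finite_measure_finite_Union[OF fin])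
    show "C ` Sigma ?H ?E \<subseteq> events"
    proof (rule image_subsetI)
      fix x
      have "C x = cylinder n (fst x) \<inter> {\<omega> \<in> space M. Y (n + 1) \<omega> = snd x}"
        by (auto simp: C_def cylinder_def)
      then show "C x \<in> events"
        using sets.Int[OF cylinder_event step_event[of "n + 1" "snd x"]] by simp
    qed
    show "disjoint_family_on C (Sigma ?H ?E)"
    proof (unfold disjoint_family_on_def, intro ballI impI)
      fix a b assume *: "a \<in> Sigma ?H ?E" "b \<in> Sigma ?H ?E" "a \<noteq> b"
      show "C a \<inter> C b = {}"
      proof (cases "fst a = fst b")
        case True
        then have "snd a \<noteq> snd b" using * by (simp add: prod_eq_iff)
        then show ?thesis by (auto simp: C_def)
      next
        case False
        then have "cylinder n (fst a) \<inter> cylinder n (fst b) = {}"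
          using * by (intro cylinder_disjoint) auto
        then show ?thesis by (auto simp: C_def)
      qed
    qed
  qed
  also have "\<dots> = (\<Sum>y\<in>?H. \<Sum>e\<in>?E y. prob {\<omega> \<in> cylinder n y. Y (n + 1) \<omega> = e})"
  proof -
    have "(\<Sum>y\<in>?H. \<Sum>e\<in>?E y. prob {\<omega> \<in> cylinder n y. Y (n + 1) \<omega> = e})
        = (\<Sum>(y, e)\<in>Sigma ?H ?E. prob {\<omega> \<in> cylinder n y. Y (n + 1) \<omega> = e})"
      using finite_histories finite_directions by (intro sum.Sigma) auto
    then show ?thesis by (simp only: split_def C_def)
  qed
  also have "\<dots> = (\<Sum>y\<in>?H. \<Sum>e\<in>?E y. step_matrix p n (y n) e * prob (cylinder n y))"
    using n by (intro sum.cong refl prob_next_step) auto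
  also have "\<dots> = (\<Sum>y\<in>?H. q * prob (cylinder n y))"
  proof (rule sum.cong[OF refl])
    fix y assume "y \<in> ?H"
    then have "y n \<in> directions" using n by auto
    from q[OF this] show "(\<Sum>e\<in>?E y. step_matrix p n (y n) e * prob (cylinder n y))
        = q * prob (cylinder n y)"
      by (simp add: sum_distrib_right[symmetric])
  qed
  also have "\<dots> = q * prob (path_event Q)"
    by (simp add: prob_path_event[OF dep] sum_distrib_left)
  finally show ?thesis .
qed

end

section \<open>Probabilities of turns and of runs ending near an axis\<close>

lemma card_le_diameter:
  fixes A :: "nat set"
  assumes "finite A" "\<And>a b. \<lbrakk>a \<in> A; b \<in> A\<rbrakk> \<Longrightarrow> b \<le> a + m"
  shows "card A \<le> m + 1"
proof (cases "A = {}")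
  case False
  then have "A \<subseteq> {Min A..Min A + m}"
    using assms(1) assms(2)[OF Min_in] by auto
  then have "card A \<le> card {Min A..Min A + m}" by (rule card_mono[rotated]) simp
  then show ?thesis by simp
qed simp

locale planar_conservative_steps = conservative_steps M p Y
  for M :: "'w measure" and p :: "nat \<Rightarrow> real" and Y :: "nat \<Rightarrow> 'w \<Rightarrow> real ^ 2" +
  assumes p_range: "\<And>n. n \<ge> 2 \<Longrightarrow> p n \<in> {0..1}"
begin

lemma refresh_prob_range: "n \<ge> 1 \<Longrightarrow> refresh_prob p n \<ge> 0" "n \<ge> 1 \<Longrightarrow> refresh_prob p n \<le> 1"
  using p_range[of n] by (auto simp: refresh_prob_def)

lemma summable_refresh_prob: "summable (refresh_prob p) \<longleftrightarrow> summable p"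
proof (rule summable_cong)
  show "\<forall>\<^sub>F n in sequentially. refresh_prob p n = p n"
    unfolding eventually_sequentially refresh_prob_def by (intro exI[of _ 2]) auto
qed

lemma prob_turn:
  assumes "n \<ge> 1" "depends_upto n Q"
  shows "prob (path_event (\<lambda>y. Q y \<and> y (n + 1) \<noteq> y n)) = 3 / 4 * refresh_prob p n * prob (path_event Q)"
  by (rule prob_path_event_step[where G = "\<lambda>f e. e \<noteq> f", OF assms sum_turn])

text \<open>By induction on \<open>m\<close>: the first \<open>m\<close> conditions are decided at
  time \<open>m + N\<close>, and the next one contributes a factor independent of the
  history.\<close>

lemma prob_no_orthogonal_turn:
  assumes "N \<ge> 1"
  shows "prob (path_event (\<lambda>y. \<forall>i<m. y (i + N) \<bullet> y (i + N + 1) \<noteq> 0))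
       = (\<Prod>i<m. 1 - refresh_prob p (i + N) / 2)"
proof (induction m)
  case 0
  then show ?case by (simp add: path_event_def prob_space)
next
  case (Suc m)
  let ?Q = "\<lambda>y :: nat \<Rightarrow> real ^ 2. \<forall>i<m. y (i + N) \<bullet> y (i + N + 1) \<noteq> 0"
  have "depends_upto (m + N) ?Q" using assms by (intro depends_uptoI) simp
  from prob_path_event_step[where G = "\<lambda>f e. f \<bullet> e \<noteq> 0", OF _ this sum_not_orthogonal] assms
  have "prob (path_event (\<lambda>y. ?Q y \<and> y (m + N) \<bullet> y (m + N + 1) \<noteq> 0))
      = (1 - refresh_prob p (m + N) / 2) * prob (path_event ?Q)" by simp
  with Suc show ?case by (simp add: All_less_Suc conj_commute mult.commute)
qed

text \<open>The probability of a turn at \<open>n\<close> is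
  \<open>3 / 4 * refresh_prob p n\<close>, so the first Borel-Cantelli lemma applies.\<close>

lemma AE_finitely_many_turns:
  assumes "summable p"
  shows "AE \<omega> in M. \<forall>\<^sub>F n in sequentially. Y (n + 1) \<omega> = Y n \<omega>"
proof -
  \<comment> \<open>The index \<open>Suc n\<close> avoids time 0, and the conjunct
    \<open>True\<close> is the trivial past event in the form of \<open>prob_turn\<close>.\<close>
  define A where "A n = path_event (\<lambda>y. True \<and> y (Suc n + 1) \<noteq> y (Suc n))" for n
  have prob_A: "prob (A n) = 3 / 4 * refresh_prob p (Suc n)" for n
    unfolding A_def using prob_turn[of "Suc n" "\<lambda>_. True"]
    by (simp add: depends_upto_def path_event_def prob_space)
  have "summable (refresh_prob p)" using assms by (simp add: summable_refresh_prob)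
  then have "summable (\<lambda>n. prob (A n))"
    unfolding prob_A by (intro summable_mult) (simp add: summable_Suc_iff)
  moreover have "A n \<in> events" for n
    unfolding A_def by (rule path_event_sets[of "n + 2"], rule depends_uptoI) simp
  ultimately have "AE \<omega> in M. \<forall>\<^sub>F n in sequentially. \<omega> \<in> space M - A n"
    by (intro borel_cantelli_AE1) (auto simp: emeasure_eq_measure)
  then show ?thesis
  proof eventually_elim
    case (elim \<omega>)
    then have "\<forall>\<^sub>F n in sequentially. Y (Suc n + 1) \<omega> = Y (Suc n) \<omega>"
      by eventually_elim (auto simp: A_def path_event_def)
    then show ?case by (rule eventually_sequentially_Suc[THEN iffD1])
  qed
qed

text \<open>Having no orthogonal turn from \<open>N\<close> on has probability at most the product
  of the factors \<open>1 - refresh_prob p n / 2\<close>, hence at most the exponential of minus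
  half the partial sums. If it were positive, its logarithm would bound these sums and
  \<open>p\<close> would be summable.\<close>

lemma AE_infinitely_many_orthogonal_turns:
  assumes "\<not> summable p"
  shows "AE \<omega> in M. \<forall>N. \<exists>n\<ge>N. Y n \<omega> \<bullet> Y (n + 1) \<omega> = 0"
proof -
  have "AE \<omega> in M. \<exists>n\<ge>N. Y n \<omega> \<bullet> Y (n + 1) \<omega> = 0" if N: "N \<ge> 1" for N
  proof -
    define E where "E = path_event (\<lambda>y. \<forall>i. y (i + N) \<bullet> y (i + N + 1) \<noteq> 0)"
    have dep: "depends_upto (i + N + 1) (\<lambda>y :: nat \<Rightarrow> real ^ 2. y (i + N) \<bullet> y (i + N + 1) \<noteq> 0)" for i
      using N by (intro depends_uptoI) simp
    have "E = (\<Inter>i. path_event (\<lambda>y. y (i + N) \<bullet> y (i + N + 1) \<noteq> 0))"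
      by (auto simp: E_def path_event_def)
    also have "\<dots> \<in> events"
      using path_event_sets[OF dep] by (intro sets.countable_INT) auto
    finally have E: "E \<in> events" .
    have bound: "prob E \<le> exp (- (\<Sum>i<m. refresh_prob p (i + N)) / 2)" for m
    proof -
      have "prob E \<le> prob (path_event (\<lambda>y. \<forall>i<m. y (i + N) \<bullet> y (i + N + 1) \<noteq> 0))"
      proof (rule finite_measure_mono)
        show "path_event (\<lambda>y. \<forall>i<m. y (i + N) \<bullet> y (i + N + 1) \<noteq> 0) \<in> events"
          by (rule path_event_sets[of "m + N"], rule depends_uptoI) (use N in simp)
      qed (auto simp: E_def path_event_def)
      also have "\<dots> = (\<Prod>i<m. 1 - refresh_prob p (i + N) / 2)"
        by (rule prob_no_orthogonal_turn[OF N])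
      also have "\<dots> \<le> (\<Prod>i<m. exp (- refresh_prob p (i + N) / 2))"
      proof (rule prod_mono)
        fix i
        show "0 \<le> 1 - refresh_prob p (i + N) / 2 \<and>
            1 - refresh_prob p (i + N) / 2 \<le> exp (- refresh_prob p (i + N) / 2)"
          using refresh_prob_range[of "i + N"] N exp_ge_add_one_self[of "- refresh_prob p (i + N) / 2"]
          by simp
      qed
      also have "\<dots> = exp (- (\<Sum>i<m. refresh_prob p (i + N)) / 2)"
        by (simp add: sum_negf sum_divide_distrib flip: exp_sum)
      finally show ?thesis .
    qed
    have "prob E = 0"
    proof (rule ccontr)
      assume "prob E \<noteq> 0"
      then have pos: "prob E > 0" by (simp add: zero_less_measure_iff)
      have "(\<Sum>i<m. refresh_prob p (i + N)) \<le> - 2 * ln (prob E)" for m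
      proof -
        have "ln (prob E) \<le> - (\<Sum>i<m. refresh_prob p (i + N)) / 2"
          using bound[of m] pos by (metis exp_gt_zero ln_exp ln_le_cancel_iff)
        then show ?thesis by simp
      qed
      then have "summable (\<lambda>i. refresh_prob p (i + N))"
        using refresh_prob_range N by (intro summableI_nonneg_bounded) auto
      then show False using assms by (simp add: summable_iff_shift summable_refresh_prob)
    qed
    then have "AE \<omega> in M. \<omega> \<notin> E" using prob_eq_0[OF E] by simp
    then show ?thesis
    proof (rule AE_mp, intro AE_I2 impI)
      fix \<omega> assume "\<omega> \<in> space M" "\<omega> \<notin> E"
      then obtain i where "Y (i + N) \<omega> \<bullet> Y (i + N + 1) \<omega> = 0" by (auto simp: E_def path_event_def)
      then show "\<exists>n\<ge>N. Y n \<omega> \<bullet> Y (n + 1) \<omega> = 0" by (intro exI[of _ "i + N"]) simp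
    qed
  qed
  \<comment> \<open>Passing to \<open>Suc N\<close> meets the condition \<open>N \<ge> 1\<close> for
    all \<open>N\<close> at once.\<close>
  then have "AE \<omega> in M. \<forall>N. \<exists>n\<ge>Suc N. Y n \<omega> \<bullet> Y (n + 1) \<omega> = 0"
    unfolding AE_all_countable by simp
  then show ?thesis by eventually_elim (meson Suc_leD)
qed

lemma path_event_run_ends_near:
  "path_event (\<lambda>y. run_ends_near y R s) = (\<Union>t\<in>{s+1..2 * s + R}. path_event (\<lambda>y.
     ((y (s + 1) \<noteq> y s \<and> \<bar>(\<Sum>k=1..s. y k) \<bullet> y (s + 1) + real (t - s)\<bar> \<le> R) \<and>
       (\<forall>u\<in>{s+1..t}. y u = y (s + 1))) \<and> y (t + 1) \<noteq> y t))"
proof -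
  have "run_ends_near (\<lambda>k. Y k \<omega>) R s \<longleftrightarrow> (\<exists>t\<in>{s+1..2 * s + R}.
     ((Y (s + 1) \<omega> \<noteq> Y s \<omega> \<and> \<bar>(\<Sum>k=1..s. Y k \<omega>) \<bullet> Y (s + 1) \<omega> + real (t - s)\<bar> \<le> R) \<and>
       (\<forall>u\<in>{s+1..t}. Y u \<omega> = Y (s + 1) \<omega>)) \<and> Y (t + 1) \<omega> \<noteq> Y t \<omega>)" if "\<omega> \<in> space M" for \<omega>
    by (intro run_ends_near_iff step_in_directions that)
  then show ?thesis unfolding path_event_def by blast
qed

text \<open>Whether a run ending at \<open>t\<close> would end near is decided at time
  \<open>s + 1\<close>. The expected number of such \<open>t\<close> is at most
  \<open>2 * R + 1\<close> times the probability of a turn at \<open>s\<close>, and for each of them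
  a turn at \<open>t\<close> costs a further factor of at most \<open>c\<close>.\<close>

lemma prob_run_ends_near:
  assumes s: "s \<ge> 1" and c: "\<And>t. t > s \<Longrightarrow> refresh_prob p t \<le> c"
  shows "path_event (\<lambda>y. run_ends_near y R s) \<in> events"
    and "prob (path_event (\<lambda>y. run_ends_near y R s)) \<le> (2 * real R + 1) * c * refresh_prob p s"
proof -
  let ?T = "{s+1..2 * s + R}"
  define near :: "nat \<Rightarrow> (nat \<Rightarrow> real ^ 2) \<Rightarrow> bool" where
    "near t y \<longleftrightarrow> y (s + 1) \<noteq> y s \<and> \<bar>(\<Sum>k=1..s. y k) \<bullet> y (s + 1) + real (t - s)\<bar> \<le> R" for t y
  define run :: "nat \<Rightarrow> (nat \<Rightarrow> real ^ 2) \<Rightarrow> bool" where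
    "run t y \<longleftrightarrow> near t y \<and> (\<forall>u\<in>{s+1..t}. y u = y (s + 1))" for t y
  define D where "D t = path_event (\<lambda>y. run t y \<and> y (t + 1) \<noteq> y t)" for t
  define turn where "turn = path_event (\<lambda>y. True \<and> y (s + 1) \<noteq> y s)"
  have union: "path_event (\<lambda>y. run_ends_near y R s) = (\<Union>t\<in>?T. D t)"
    unfolding path_event_run_ends_near D_def run_def near_def ..
  have near_cong: "near t y = near t z" if "\<And>k. \<lbrakk>1 \<le> k; k \<le> s + 1\<rbrakk> \<Longrightarrow> y k = z k" for t y z
  proof -
    have "(\<Sum>k=1..s. y k) = (\<Sum>k=1..s. z k)" using that by (intro sum.cong) auto
    then show ?thesis unfolding near_def using that[of s] that[of "s + 1"] s by simp
  qed
  have dep_near: "depends_upto (s + 1) (near t)" for t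
    by (rule depends_uptoI) (rule near_cong)
  have dep_run: "depends_upto t (run t)" if "t > s" for t
  proof (rule depends_uptoI)
    fix y z :: "nat \<Rightarrow> real ^ 2"
    assume eq: "\<And>k. \<lbrakk>1 \<le> k; k \<le> t\<rbrakk> \<Longrightarrow> y k = z k"
    have "near t y = near t z" using that by (intro near_cong eq) auto
    moreover have "y u = z u" if "u \<in> {s+1..t}" for u using that by (intro eq) auto
    ultimately show "run t y = run t z" unfolding run_def using that by simp
  qed
  have D_event: "D t \<in> events" if "t > s" for t
    unfolding D_def
  proof (rule path_event_sets[of "t + 1"], rule depends_uptoI)
    fix y z :: "nat \<Rightarrow> real ^ 2"
    assume eq: "\<And>k. \<lbrakk>1 \<le> k; k \<le> t + 1\<rbrakk> \<Longrightarrow> y k = z k"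
    have "run t y = run t z" by (rule depends_uptoD[OF dep_run[OF that]]) (simp add: eq)
    then show "(run t y \<and> y (t + 1) \<noteq> y t) = (run t z \<and> z (t + 1) \<noteq> z t)"
      using eq[of t] eq[of "t + 1"] that by simp
  qed
  show "path_event (\<lambda>y. run_ends_near y R s) \<in> events"
    unfolding union by (intro sets.finite_UN D_event) auto
  have c_nonneg: "c \<ge> 0" using c[of "s + 1"] refresh_prob_range(1)[of "s + 1"] by simp
  have near_event: "path_event (near t) \<in> events" for t by (rule path_event_sets[OF dep_near])
  have prob_D: "prob (D t) \<le> c * prob (path_event (near t))" if "t > s" for t
  proof -
    have "prob (D t) = 3 / 4 * refresh_prob p t * prob (path_event (run t))"
      unfolding D_def using that by (intro prob_turn dep_run) auto
    \<comment> \<open>Dropping the condition that the run lasts until \<open>t\<close> leaves an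
      event decided at time \<open>s + 1\<close>, for which the values of \<open>t\<close> can be
      counted.\<close>
    also have "\<dots> \<le> c * prob (path_event (near t))"
    proof (rule mult_mono)
      show "3 / 4 * refresh_prob p t \<le> c"
        using c[OF that] refresh_prob_range(1)[of t] that by simp
      show "prob (path_event (run t)) \<le> prob (path_event (near t))"
        by (rule finite_measure_mono[OF _ near_event]) (auto simp: path_event_def run_def)
    qed (use c_nonneg in auto)
    finally show ?thesis .
  qed
  have turn_event: "turn \<in> events"
    unfolding turn_def by (rule path_event_sets[of "s + 1"], rule depends_uptoI) (use s in simp)
  \<comment> \<open>The sum is the expected number of near values of \<open>t\<close>, which is
    bounded pointwise: by \<open>2 * R + 1\<close> on \<open>turn\<close> and by 0
    elsewhere.\<close>
  have "(\<Sum>t\<in>?T. prob (path_event (near t))) = (\<integral>\<omega>. (\<Sum>t\<in>?T. indicator (path_event (near t)) \<omega>) \<partial>M)"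
    using near_event by (subst Bochner_Integration.integral_sum) (auto simp: emeasure_eq_measure)
  also have "\<dots> \<le> (\<integral>\<omega>. (2 * real R + 1) * indicator turn \<omega> \<partial>M)"
  proof (rule integral_mono)
    fix \<omega> assume w: "\<omega> \<in> space M"
    show "(\<Sum>t\<in>?T. indicator (path_event (near t)) \<omega>) \<le> (2 * real R + 1) * indicator turn \<omega>"
    proof (cases "\<omega> \<in> turn")
      case True
      let ?A = "{t \<in> ?T. \<omega> \<in> path_event (near t)}"
      \<comment> \<open>Each \<open>t\<close> in the set puts a fixed number plus
        \<open>t - s\<close> into \<open>[-R, R]\<close>, so any two differ by at most
        \<open>2 * R\<close>.\<close>
      have "card ?A \<le> 2 * R + 1"
        by (rule card_le_diameter) (auto simp: path_event_def near_def abs_le_iff)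
      moreover have "(\<Sum>t\<in>?T. indicator (path_event (near t)) \<omega>) = real (card ?A)"
        by (simp add: indicator_def sum.If_cases Int_def)
      ultimately show ?thesis using True by simp
    next
      case False
      then have "\<omega> \<notin> path_event (near t)" for t using w by (auto simp: turn_def path_event_def near_def)
      then show ?thesis using False by simp
    qed
  qed (use near_event turn_event in \<open>auto simp: emeasure_eq_measure\<close>)
  also have "\<dots> = (2 * real R + 1) * prob turn" using turn_event by simp
  also have "prob turn \<le> refresh_prob p s"
    unfolding turn_def using prob_turn[OF s, of "\<lambda>_. True"] refresh_prob_range(1)[OF s]
    by (simp add: depends_upto_def path_event_def prob_space)
  finally have near_sum: "(\<Sum>t\<in>?T. prob (path_event (near t))) \<le> (2 * real R + 1) * refresh_prob p s"
    by (simp add: mult_left_mono)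
  have "prob (path_event (\<lambda>y. run_ends_near y R s)) \<le> (\<Sum>t\<in>?T. prob (D t))"
    unfolding union using D_event by (intro finite_measure_subadditive_finite) auto
  also have "\<dots> \<le> (\<Sum>t\<in>?T. c * prob (path_event (near t)))"
    using prob_D by (intro sum_mono) auto
  also have "\<dots> \<le> c * ((2 * real R + 1) * refresh_prob p s)"
    using near_sum c_nonneg by (simp add: mult_left_mono flip: sum_distrib_left)
  finally show "prob (path_event (\<lambda>y. run_ends_near y R s)) \<le> (2 * real R + 1) * c * refresh_prob p s"
    by (simp add: algebra_simps)
qed

text \<open>The decay bound enters twice, for the turn at \<open>s\<close> and for the turn ending
  the run. The exponents add up to \<open>- 1 - 2 * \<epsilon>\<close>, which is summable, and the
  first Borel-Cantelli lemma applies.\<close>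

lemma AE_eventually_no_run_ends_near:
  assumes "\<epsilon> > 0" and decay: "\<And>n. \<lbrakk>n \<ge> n0; n \<ge> 2\<rbrakk> \<Longrightarrow> p n < real n powr (- 1 / 2 - \<epsilon>)"
  shows "AE \<omega> in M. \<forall>\<^sub>F s in sequentially. \<not> run_ends_near (\<lambda>k. Y k \<omega>) R s"
proof -
  define B where "B n = path_event (\<lambda>y. run_ends_near y R (Suc n))" for n
  have B_event: "B n \<in> events" for n
    unfolding B_def by (rule prob_run_ends_near(1)[where c = 1]) (use refresh_prob_range in auto)
  have bound: "prob (B n) \<le> (2 * real R + 1) * real (Suc n) powr (- 1 - 2 * \<epsilon>)"
    \<comment> \<open>Then \<open>Suc n\<close> is at least 2 and at least \<open>n0\<close>, so
      \<open>decay\<close> holds from \<open>Suc n\<close> on and \<open>refresh_prob\<close> agrees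
      with \<open>p\<close> there.\<close>
    if n: "n \<ge> n0 + 1" for n
  proof -
    let ?c = "real (Suc n) powr (- 1 / 2 - \<epsilon>)"
    have small: "refresh_prob p t \<le> ?c" if "t \<ge> Suc n" for t
    proof -
      have "refresh_prob p t \<le> real t powr (- 1 / 2 - \<epsilon>)"
        using decay[of t] that n by (simp add: refresh_prob_def)
      also have "\<dots> \<le> ?c" using that \<open>\<epsilon> > 0\<close> by (intro powr_mono2') auto
      finally show ?thesis .
    qed
    have "prob (B n) \<le> (2 * real R + 1) * ?c * refresh_prob p (Suc n)"
      unfolding B_def by (rule prob_run_ends_near(2)) (use small in auto)
    also have "\<dots> \<le> (2 * real R + 1) * ?c * ?c"
      using small[of "Suc n"] by (intro mult_left_mono) auto
    also have "\<dots> = (2 * real R + 1) * real (Suc n) powr (- 1 - 2 * \<epsilon>)"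
      by (simp add: mult.assoc flip: powr_add)
    finally show ?thesis .
  qed
  have "summable (\<lambda>n. real (Suc n) powr (- 1 - 2 * \<epsilon>))"
    using \<open>\<epsilon> > 0\<close> by (subst summable_Suc_iff) (simp add: summable_real_powr_iff)
  then have "summable (\<lambda>n. (2 * real R + 1) * real (Suc n) powr (- 1 - 2 * \<epsilon>))"
    by (rule summable_mult)
  then have "summable (\<lambda>n. prob (B n))"
    by (rule summable_comparison_test[rotated]) (use bound in \<open>auto intro!: exI[of _ "n0 + 1"]\<close>)
  with B_event have "AE \<omega> in M. \<forall>\<^sub>F n in sequentially. \<omega> \<in> space M - B n"
    by (intro borel_cantelli_AE1) (auto simp: emeasure_eq_measure)
  then show ?thesis
  proof eventually_elim
    case (elim \<omega>)
    then have "\<forall>\<^sub>F n in sequentially. \<not> run_ends_near (\<lambda>k. Y k \<omega>) R (Suc n)"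
      by eventually_elim (auto simp: B_def path_event_def)
    then show ?case by (rule eventually_sequentially_Suc[THEN iffD1])
  qed
qed

end

theorem theorem5p2:
  fixes M :: "'w measure"
    and p :: "nat \<Rightarrow> real"
    and Y :: "nat \<Rightarrow> 'w \<Rightarrow> real ^ 2"
    and n0 :: nat and \<epsilon> :: real
  assumes "\<And>n. n \<ge> 2 \<Longrightarrow> p n \<in> {0..1}"
    and "\<epsilon> > 0"
    and "\<And>n. n \<ge> n0 \<Longrightarrow> n \<ge> 2 \<Longrightarrow> p n < real n powr (- 1 / 2 - \<epsilon>)"
    and "conservative_steps M p Y"
  shows "strongly_transient M (walk Y)"
proof -
  interpret planar_conservative_steps M p Y
    using assms(1,4) by (simp add: planar_conservative_steps_def planar_conservative_steps_axioms_def)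
  show ?thesis
  proof (cases "summable p")
    case True
    from AE_finitely_many_turns[OF this] AE_space
    show ?thesis unfolding strongly_transient_def walk_def
    proof eventually_elim
      case (elim \<omega>)
      then show ?case by (intro straight_path_unbounded step_in_directions)
    qed
  next
    case False
    \<comment> \<open>Since \<open>R\<close> is a natural number, the exceptional null sets form a
      countable family.\<close>
    have "AE \<omega> in M. \<forall>R. \<forall>\<^sub>F s in sequentially. \<not> run_ends_near (\<lambda>k. Y k \<omega>) R s"
      unfolding AE_all_countable using AE_eventually_no_run_ends_near[OF assms(2,3)] by blast
    with AE_infinitely_many_orthogonal_turns[OF False] AE_space
    show ?thesis unfolding strongly_transient_def walk_def
    proof eventually_elim
      case (elim \<omega>)
      then show ?case by (intro turning_path_unbounded step_in_directions) auto
    qed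
  qed
qed

end
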